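(* Let $\mathfrak g\xrightarrow{\mu}\mathfrak h$ be a crossed module of Lie algebras, $\phi:W\to V$ linear, $\rho$ a 2-representation on $\phi$, $r\ge1$ and $\omega\in C^{p,q}_r(\mathfrak g_1,\phi)$. Then $(\partial\Delta+\Delta\partial)\omega=0\in C^{p+2,q+1}_{r-1}(\mathfrak g_1,\phi)$.
   Context: Crossed module: Lie algebras $\mathfrak g,\mathfrak h$, Lie homomorphism $\mu$, action $\mathcal L:\mathfrak h\to\mathrm{Der}(\mathfrak g)$ with $\mu(\mathcal L_yx)=[y,\mu(x)]$, $\mathcal L_{\mu(x_0)}x_1=[x_0,x_1]$. 2-representation: linear $\rho_0^1:\mathfrak h\to\mathfrak{gl}(W)$, $\rho_0^0:\mathfrak h\to\mathfrak{gl}(V)$, $\rho_1:\mathfrak g\to\mathrm{Hom}(V,W)$ satisfying the usual axioms (representations, $\phi\rho_0^1(y)=\rho_0^0(y)\phi$, $\rho_1([x_0,x_1])=\rho_1(x_0)\phi\rho_1(x_1)-\rho_1(x_1)\phi\rho_1(x_0)$, $\rho_0^0(\mu(x))=\phi\rho_1(x)$, $\rho_0^1(\mu(x))=\rho_1(x)\phi$, $\rho_1(\mathcal L_yx)=\rho_0^1(y)\rho_1(x)-\rho_1(x)\rho_0^0(y)$). $\mathfrak g_0=\mathfrak h$; for $p\ge1$, $\mathfrak g_p=\mathfrak g^p\oplus\mathfrak h$, elements $(x^0,\dots,x^{p-1};y)$ (composable strings of arrows of $\mathfrak g\oplus_{\mathcal L}\mathfrak h$, a Lie algebra with componentwise bracket).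 Face maps $\partial_k:\mathfrak g_{p+1}\to\mathfrak g_p$, $0\le k\le p+1$: $\partial_0(x^0,\dots,x^p;y)=(x^1,\dots,x^p;y)$, $\partial_k(\dots)=(x^0,\dots,x^{k-1}+x^k,\dots,x^p;y)$ ($0<k\le p$), $\partial_{p+1}(\dots)=(x^0,\dots,x^{p-1};y+\mu(x^p))$, componentwise on tuples. $X(j)$: removal of the $j$th entry. $C^{p,q}_r=\bigwedge^q\mathfrak g_p^*\otimes\bigwedge^r\mathfrak g^*\otimes W$ ($r\ge1$), $C^{p,q}_0=\bigwedge^q\mathfrak g_p^*\otimes V$, elements $\omega(\Xi;Z)$. $\partial:C^{p,q}_r\to C^{p+1,q}_r$, $\partial\omega(\Xi;Z)=\sum_{k=0}^{p+1}(-1)^k\omega(\partial_k\Xi;Z)$. $\Delta:C^{p,q}_r\to C^{p+1,q+1}_{r-1}$ ($r\ge1$): for $\Xi=(\xi_0,\dots,\xi_q)\in\mathfrak g_{p+1}^{q+1}$, $\xi_j=(x_j^0,\dots,x_j^p;y_j)$, $\Delta\omega(\Xi;Z)=\sum_j(-1)^j\omega(\partial_0\Xi(j);x_j^0,Z)$, composed with $\phi$ when $r=1$. *)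

theory Defs
  imports Main "HOL.Real_Vector_Spaces"
begin

section \<open>Lie algebras, crossed modules, 2-representations (over the reals)\<close>

definition lie_algebra :: "('a::real_vector \<Rightarrow> 'a \<Rightarrow> 'a) \<Rightarrow> bool" where
  "lie_algebra br \<longleftrightarrow>
     (\<forall>x. linear (br x)) \<and> (\<forall>y. linear (\<lambda>x. br x y)) \<and>
     (\<forall>x. br x x = 0) \<and>
     (\<forall>x y z. br x (br y z) + br y (br z x) + br z (br x y) = 0)"

definition lie_hom :: "('a::real_vector \<Rightarrow> 'a \<Rightarrow> 'a) \<Rightarrow> ('b::real_vector \<Rightarrow> 'b \<Rightarrow> 'b)
    \<Rightarrow> ('a \<Rightarrow> 'b) \<Rightarrow> bool" where
  "lie_hom bra brb f \<longleftrightarrow> linear f \<and> (\<forall>x y. f (bra x y) = brb (f x) (f y))"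

definition derivation :: "('a::real_vector \<Rightarrow> 'a \<Rightarrow> 'a) \<Rightarrow> ('a \<Rightarrow> 'a) \<Rightarrow> bool" where
  "derivation br D \<longleftrightarrow> linear D \<and> (\<forall>x y. D (br x y) = br (D x) y + br x (D y))"

text \<open>Crossed module \<open>\<mu> : g \<rightarrow> h\<close> with action \<open>L : h \<rightarrow> Der(g)\<close> (a Lie algebra homomorphism).\<close>
definition crossed_module :: "('g::real_vector \<Rightarrow> 'g \<Rightarrow> 'g) \<Rightarrow> ('h::real_vector \<Rightarrow> 'h \<Rightarrow> 'h)
    \<Rightarrow> ('g \<Rightarrow> 'h) \<Rightarrow> ('h \<Rightarrow> 'g \<Rightarrow> 'g) \<Rightarrow> bool" where
  "crossed_module brg brh \<mu> L \<longleftrightarrow>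
     lie_algebra brg \<and> lie_algebra brh \<and> lie_hom brg brh \<mu> \<and>
     (\<forall>x. linear (\<lambda>y. L y x)) \<and> (\<forall>y. derivation brg (L y)) \<and>
     (\<forall>y y' x. L (brh y y') x = L y (L y' x) - L y' (L y x)) \<and>
     (\<forall>y x. \<mu> (L y x) = brh y (\<mu> x)) \<and>
     (\<forall>x0 x1. L (\<mu> x0) x1 = brg x0 x1)"

text \<open>2-representation of the crossed module on the 2-term complex \<open>\<phi> : W \<rightarrow> V\<close>.\<close>
definition two_rep :: "('g::real_vector \<Rightarrow> 'g \<Rightarrow> 'g) \<Rightarrow> ('h::real_vector \<Rightarrow> 'h \<Rightarrow> 'h)
    \<Rightarrow> ('g \<Rightarrow> 'h) \<Rightarrow> ('h \<Rightarrow> 'g \<Rightarrow> 'g) \<Rightarrow> ('w::real_vector \<Rightarrow> 'v::real_vector)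
    \<Rightarrow> ('h \<Rightarrow> 'w \<Rightarrow> 'w) \<Rightarrow> ('h \<Rightarrow> 'v \<Rightarrow> 'v) \<Rightarrow> ('g \<Rightarrow> 'v \<Rightarrow> 'w) \<Rightarrow> bool" where
  "two_rep brg brh \<mu> L \<phi> \<rho>01 \<rho>00 \<rho>1 \<longleftrightarrow>
     linear \<phi> \<and>
     (\<forall>w. linear (\<lambda>a. \<rho>01 a w)) \<and> (\<forall>y. linear (\<rho>01 y)) \<and>
     (\<forall>v. linear (\<lambda>a. \<rho>00 a v)) \<and> (\<forall>y. linear (\<rho>00 y)) \<and>
     (\<forall>v. linear (\<lambda>a. \<rho>1 a v)) \<and> (\<forall>x. linear (\<rho>1 x)) \<and>
     (\<forall>y y' w. \<rho>01 (brh y y') w = \<rho>01 y (\<rho>01 y' w) - \<rho>01 y' (\<rho>01 y w)) \<and>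
     (\<forall>y y' v. \<rho>00 (brh y y') v = \<rho>00 y (\<rho>00 y' v) - \<rho>00 y' (\<rho>00 y v)) \<and>
     (\<forall>y w. \<phi> (\<rho>01 y w) = \<rho>00 y (\<phi> w)) \<and>
     (\<forall>x0 x1 v. \<rho>1 (brg x0 x1) v = \<rho>1 x0 (\<phi> (\<rho>1 x1 v)) - \<rho>1 x1 (\<phi> (\<rho>1 x0 v))) \<and>
     (\<forall>x v. \<rho>00 (\<mu> x) v = \<phi> (\<rho>1 x v)) \<and>
     (\<forall>x w. \<rho>01 (\<mu> x) w = \<rho>1 x (\<phi> w)) \<and>
     (\<forall>y x v. \<rho>1 (L y x) v = \<rho>01 y (\<rho>1 x v) - \<rho>1 x (\<rho>00 y v))"

section \<open>The simplicial spaces \<open>g_p\<close> and their face maps\<close>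

text \<open>An element \<open>(x^0,\<dots>,x^{p-1}; y)\<close> of \<open>g_p = g^p \<oplus> h\<close> is a pair (list of length p, y);
  \<open>g_0 = h\<close> corresponds to the pairs with empty list.\<close>

definition gp :: "nat \<Rightarrow> ('g list \<times> 'h) set" where
  "gp p = {\<xi>. length (fst \<xi>) = p}"

definition gp_add :: "('g::real_vector list \<times> 'h::real_vector) \<Rightarrow> ('g list \<times> 'h) \<Rightarrow> ('g list \<times> 'h)" where
  "gp_add a b = (map2 (+) (fst a) (fst b), snd a + snd b)"

definition gp_scale :: "real \<Rightarrow> ('g::real_vector list \<times> 'h::real_vector) \<Rightarrow> ('g list \<times> 'h)" where
  "gp_scale c a = (map (scaleR c) (fst a), scaleR c (snd a))"

text \<open>Face map \<open>\<partial>_k : g_{p+1} \<rightarrow> g_p\<close>, applied to \<open>(x^0,\<dots>,x^p; y)\<close> (list of length n = p+1).\<close>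
definition face :: "('g::real_vector \<Rightarrow> 'h::real_vector) \<Rightarrow> nat \<Rightarrow> ('g list \<times> 'h) \<Rightarrow> ('g list \<times> 'h)" where
  "face \<mu> k \<xi> =
     (let xs = fst \<xi>; y = snd \<xi> in
      if k = 0 then (tl xs, y)
      else if k < length xs then (take (k - 1) xs @ [xs ! (k - 1) + xs ! k] @ drop (k + 1) xs, y)
      else (butlast xs, y + \<mu> (last xs)))"

text \<open>\<open>X(j)\<close>: removal of the j-th entry.\<close>
definition remove_nth :: "nat \<Rightarrow> 'a list \<Rightarrow> 'a list" where
  "remove_nth j xs = take j xs @ drop (Suc j) xs"

section \<open>Cochains\<close>

text \<open>Multilinear alternating functions of n arguments from a carrier D with given addition/scaling.\<close>
definition multilin_alt :: "'a set \<Rightarrow> ('a \<Rightarrow> 'a \<Rightarrow> 'a) \<Rightarrow> (real \<Rightarrow> 'a \<Rightarrow> 'a) \<Rightarrow> nat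
    \<Rightarrow> ('a list \<Rightarrow> 'b::real_vector) \<Rightarrow> bool" where
  "multilin_alt D add sc n f \<longleftrightarrow>
     (\<forall>xs i a b. length xs = n \<and> set xs \<subseteq> D \<and> i < n \<and> a \<in> D \<and> b \<in> D \<longrightarrow>
        f (xs[i := add a b]) = f (xs[i := a]) + f (xs[i := b])) \<and>
     (\<forall>xs i c a. length xs = n \<and> set xs \<subseteq> D \<and> i < n \<and> a \<in> D \<longrightarrow>
        f (xs[i := sc c a]) = c *\<^sub>R f (xs[i := a])) \<and>
     (\<forall>xs i j. length xs = n \<and> set xs \<subseteq> D \<and> i < n \<and> j < n \<and> i \<noteq> j \<and> xs ! i = xs ! j \<longrightarrow>
        f xs = 0)"

text \<open>\<open>\<omega> \<in> C^{p,q}_r\<close>: \<open>\<omega>(\<Xi>;Z)\<close> with \<open>\<Xi>\<close> a q-tuple in \<open>g_p\<close> and Z an r-tuple in g,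
  alternating multilinear in each group of arguments (values in W for \<open>r \<ge> 1\<close>, in V for r = 0).\<close>
definition cochain :: "nat \<Rightarrow> nat \<Rightarrow> nat
    \<Rightarrow> (('g::real_vector list \<times> 'h::real_vector) list \<Rightarrow> 'g list \<Rightarrow> 'w::real_vector) \<Rightarrow> bool" where
  "cochain p q r \<omega> \<longleftrightarrow>
     (\<forall>Z. length Z = r \<longrightarrow> multilin_alt (gp p) gp_add gp_scale q (\<lambda>\<Xi>. \<omega> \<Xi> Z)) \<and>
     (\<forall>\<Xi>. length \<Xi> = q \<and> set \<Xi> \<subseteq> gp p \<longrightarrow> multilin_alt UNIV (+) (*\<^sub>R) r (\<lambda>Z. \<omega> \<Xi> Z))"

text \<open>\<open>\<partial> : C^{p,q}_r \<rightarrow> C^{p+1,q}_r\<close>.\<close>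
definition bdry :: "('g::real_vector \<Rightarrow> 'h::real_vector) \<Rightarrow> nat
    \<Rightarrow> (('g list \<times> 'h) list \<Rightarrow> 'g list \<Rightarrow> 'w::real_vector)
    \<Rightarrow> (('g list \<times> 'h) list \<Rightarrow> 'g list \<Rightarrow> 'w)" where
  "bdry \<mu> p \<omega> \<Xi> Z = (\<Sum>k = 0..p + 1. ((-1::real) ^ k) *\<^sub>R \<omega> (map (face \<mu> k) \<Xi>) Z)"

text \<open>\<open>\<Delta> : C^{p,q}_r \<rightarrow> C^{p+1,q+1}_{r-1}\<close> (before composing with \<open>\<phi>\<close>, which is done when r = 1).\<close>
definition Delta :: "('g::real_vector \<Rightarrow> 'h::real_vector)
    \<Rightarrow> (('g list \<times> 'h) list \<Rightarrow> 'g list \<Rightarrow> 'w::real_vector)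
    \<Rightarrow> (('g list \<times> 'h) list \<Rightarrow> 'g list \<Rightarrow> 'w)" where
  "Delta \<mu> \<omega> \<Xi> Z = (\<Sum>j < length \<Xi>. ((-1::real) ^ j) *\<^sub>R
        \<omega> (map (face \<mu> 0) (remove_nth j \<Xi>)) (hd (fst (\<Xi> ! j)) # Z))"

end

theory Submission
  imports Defs
begin

text \<open>
  Only the simplicial structure of the spaces \<open>g_p\<close> enters. Expanding \<open>\<partial>\<Delta>\<omega>\<close> and \<open>\<Delta>\<partial>\<omega>\<close> as
  double sums over the removed argument \<open>j\<close> and the face index \<open>k\<close>, the identities
  \<open>\<partial>\<^sub>0\<partial>\<^sub>k\<^sub>+\<^sub>1 = \<partial>\<^sub>k\<partial>\<^sub>0\<close> (\<open>k \<ge> 1\<close>), together with the fact that \<open>\<partial>\<^sub>k\<close> for \<open>k \<ge> 2\<close> leaves the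
  first arrow \<open>x\<^sup>0\<close> unchanged, make all terms cancel in pairs except those with \<open>k \<le> 1\<close>.
  These remaining three terms cancel because \<open>\<partial>\<^sub>0\<partial>\<^sub>1 = \<partial>\<^sub>0\<partial>\<^sub>0\<close>, \<open>\<partial>\<^sub>1\<close> composes the first two
  arrows to \<open>x\<^sup>0 + x\<^sup>1\<close>, and \<omega> is additive in its first \<open>\<frak>g\<close>-argument.
\<close>

lemma map_remove_nth: "map f (remove_nth j xs) = remove_nth j (map f xs)"
  by (simp add: remove_nth_def take_map drop_map)

lemma length_remove_nth: "j < length xs \<Longrightarrow> length (remove_nth j xs) = length xs - 1"
  by (simp add: remove_nth_def)

lemma set_remove_nth_subset: "set (remove_nth j xs) \<subseteq> set xs"
  by (auto simp: remove_nth_def dest: in_set_takeD in_set_dropD)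

lemma face_0: "face \<mu> 0 \<xi> = (tl (fst \<xi>), snd \<xi>)"
  by (simp add: face_def Let_def)

lemma face_in_gp: "\<xi> \<in> gp (Suc p) \<Longrightarrow> face \<mu> k \<xi> \<in> gp p"
  by (auto simp: gp_def face_def Let_def min_def)

lemma face_0_face_Suc:
  assumes "1 \<le> k" "Suc k \<le> length (fst \<xi>)"
  shows "face \<mu> 0 (face \<mu> (Suc k) \<xi>) = face \<mu> k (face \<mu> 0 \<xi>)"
proof -
  obtain a b xs y where \<xi>: "\<xi> = (a # b # xs, y)"
    using assms by (cases \<xi>; cases "fst \<xi>"; cases "tl (fst \<xi>)") auto
  obtain m where "k = Suc m"
    using assms(1) by (cases k) auto
  then show ?thesis
    using assms by (cases "Suc k < length (fst \<xi>)") (simp_all add: \<xi> face_def Let_def)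
qed

lemma face_0_face_1:
  "2 \<le> length (fst \<xi>) \<Longrightarrow> face \<mu> 0 (face \<mu> 1 \<xi>) = face \<mu> 0 (face \<mu> 0 \<xi>)"
  by (cases \<xi>; cases "fst \<xi>"; cases "tl (fst \<xi>)") (auto simp: face_def Let_def)

lemma hd_face_1:
  "2 \<le> length (fst \<xi>) \<Longrightarrow> hd (fst (face \<mu> 1 \<xi>)) = hd (fst \<xi>) + hd (tl (fst \<xi>))"
  by (cases \<xi>; cases "fst \<xi>"; cases "tl (fst \<xi>)") (auto simp: face_def Let_def)

lemma hd_face_Suc_Suc:
  "2 \<le> length (fst \<xi>) \<Longrightarrow> hd (fst (face \<mu> (Suc (Suc k)) \<xi>)) = hd (fst \<xi>)"
  by (cases \<xi>; cases "fst \<xi>"; cases "tl (fst \<xi>)") (auto simp: face_def Let_def)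

lemma cochain_add_first_arg:
  assumes "cochain p q r \<omega>" "length Z = r - 1" "1 \<le> r"
    and "length \<Xi> = q" "set \<Xi> \<subseteq> gp p"
  shows "\<omega> \<Xi> ((a + b) # Z) = \<omega> \<Xi> (a # Z) + \<omega> \<Xi> (b # Z)"
proof -
  have "multilin_alt UNIV (+) (*\<^sub>R) r (\<omega> \<Xi>)"
    using assms unfolding cochain_def by blast
  then have "\<omega> \<Xi> ((a # Z)[0 := a + b]) = \<omega> \<Xi> ((a # Z)[0 := a]) + \<omega> \<Xi> ((a # Z)[0 := b])"
    using assms unfolding multilin_alt_def by (elim conjE allE[of _ "a # Z"]) auto
  then show ?thesis
    by simp
qed

lemma alternating_sums_cancel:
  fixes A B :: "nat \<Rightarrow> 'a::real_vector"
  assumes "\<And>k. 1 \<le> k \<Longrightarrow> k \<le> n \<Longrightarrow> A (Suc k) = B k"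
    and "A 0 - A 1 + B 0 = 0"
  shows "(\<Sum>k = 0..Suc n. (-1::real) ^ k *\<^sub>R A k) + (\<Sum>k = 0..n. (-1::real) ^ k *\<^sub>R B k) = 0"
  using assms(1)
proof (induction n)
  case 0
  then show ?case
    using assms(2) by simp
next
  case (Suc n)
  then have "(-1::real) ^ Suc (Suc n) *\<^sub>R A (Suc (Suc n)) + (-1::real) ^ Suc n *\<^sub>R B (Suc n) = 0"
    by simp
  with Suc show ?case
    by (simp add: algebra_simps)
qed

lemma bdry_comp_linear:
  assumes "linear f"
  shows "bdry \<mu> p (\<lambda>\<Xi>' Z'. f (\<omega> \<Xi>' Z')) \<Xi> Z = f (bdry \<mu> p \<omega> \<Xi> Z)"
  unfolding bdry_def by (simp only: linear_sum[OF assms] linear_scale[OF assms])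

lemma bdry_Delta_expand:
  "bdry \<mu> (p + 1) (Delta \<mu> \<omega>) \<Xi> Z =
     (\<Sum>j < length \<Xi>. (-1::real) ^ j *\<^sub>R (\<Sum>k = 0..p + 2. (-1::real) ^ k *\<^sub>R
        \<omega> (remove_nth j (map (face \<mu> 0 \<circ> face \<mu> k) \<Xi>)) (hd (fst (face \<mu> k (\<Xi> ! j))) # Z)))"
proof -
  have "bdry \<mu> (p + 1) (Delta \<mu> \<omega>) \<Xi> Z =
     (\<Sum>k = 0..p + 2. \<Sum>j < length \<Xi>. (-1::real) ^ k *\<^sub>R (-1::real) ^ j *\<^sub>R
        \<omega> (remove_nth j (map (face \<mu> 0 \<circ> face \<mu> k) \<Xi>)) (hd (fst (face \<mu> k (\<Xi> ! j))) # Z))"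
    unfolding bdry_def Delta_def
    by (auto simp: map_remove_nth scaleR_sum_right intro!: sum.cong)
  also have "\<dots> = (\<Sum>j < length \<Xi>. (-1::real) ^ j *\<^sub>R (\<Sum>k = 0..p + 2. (-1::real) ^ k *\<^sub>R
        \<omega> (remove_nth j (map (face \<mu> 0 \<circ> face \<mu> k) \<Xi>)) (hd (fst (face \<mu> k (\<Xi> ! j))) # Z)))"
    by (subst sum.swap) (simp only: scaleR_sum_right scaleR_scaleR mult.commute)
  finally show ?thesis .
qed

lemma Delta_bdry_expand:
  "Delta \<mu> (bdry \<mu> p \<omega>) \<Xi> Z =
     (\<Sum>j < length \<Xi>. (-1::real) ^ j *\<^sub>R (\<Sum>k = 0..p + 1. (-1::real) ^ k *\<^sub>R
        \<omega> (remove_nth j (map (face \<mu> k \<circ> face \<mu> 0) \<Xi>)) (hd (fst (\<Xi> ! j)) # Z)))"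
  unfolding bdry_def Delta_def by (simp add: map_remove_nth)

lemma bdry_Delta_add_Delta_bdry:
  assumes \<omega>: "cochain p q r \<omega>" and r: "1 \<le> r"
    and \<Xi>: "length \<Xi> = q + 1" "set \<Xi> \<subseteq> gp (p + 2)" and Z: "length Z = r - 1"
  shows "bdry \<mu> (p + 1) (Delta \<mu> \<omega>) \<Xi> Z + Delta \<mu> (bdry \<mu> p \<omega>) \<Xi> Z = 0"
proof -
  define A where "A j k = \<omega> (remove_nth j (map (face \<mu> 0 \<circ> face \<mu> k) \<Xi>))
    (hd (fst (face \<mu> k (\<Xi> ! j))) # Z)" for j k
  define B where "B j k = \<omega> (remove_nth j (map (face \<mu> k \<circ> face \<mu> 0) \<Xi>)) (hd (fst (\<Xi> ! j)) # Z)"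
    for j k
  have long: "2 \<le> length (fst \<xi>)" if "\<xi> \<in> set \<Xi>" for \<xi>
    using that \<Xi>(2) by (auto simp: gp_def)
  have cancel: "(\<Sum>k = 0..Suc (p + 1). (-1::real) ^ k *\<^sub>R A j k)
      + (\<Sum>k = 0..p + 1. (-1::real) ^ k *\<^sub>R B j k) = 0" if j: "j < length \<Xi>" for j
  proof (rule alternating_sums_cancel)
    fix k assume k: "1 \<le> k" "k \<le> p + 1"
    have faces: "map (face \<mu> 0 \<circ> face \<mu> (Suc k)) \<Xi> = map (face \<mu> k \<circ> face \<mu> 0) \<Xi>"
      using k \<Xi>(2) by (auto simp: gp_def intro!: face_0_face_Suc)
    from k obtain m where "k = Suc m"
      by (cases k) auto
    then show "A j (Suc k) = B j k"
      unfolding A_def B_def faces by (simp only: hd_face_Suc_Suc[OF long[OF nth_mem[OF j]]])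
  next
    let ?\<Xi>' = "remove_nth j (map (face \<mu> 0 \<circ> face \<mu> 0) \<Xi>)"
    have "set ?\<Xi>' \<subseteq> gp p"
      using set_remove_nth_subset \<Xi>(2) by (fastforce intro: face_in_gp)
    moreover have "length ?\<Xi>' = q"
      using j \<Xi>(1) by (simp add: length_remove_nth)
    ultimately have additive: "\<omega> ?\<Xi>' ((a + b) # Z) = \<omega> ?\<Xi>' (a # Z) + \<omega> ?\<Xi>' (b # Z)" for a b
      using cochain_add_first_arg[OF \<omega> Z r] by blast
    have faces: "map (face \<mu> 0 \<circ> face \<mu> 1) \<Xi> = map (face \<mu> 0 \<circ> face \<mu> 0) \<Xi>"
      using face_0_face_1 long by (metis (no_types, lifting) comp_apply map_cong)
    have "A j 1 = B j 0 + A j 0"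
      unfolding A_def B_def faces hd_face_1[OF long[OF nth_mem[OF j]]] face_0[of \<mu> "\<Xi> ! j"] fst_conv
      by (rule additive)
    then show "A j 0 - A j 1 + B j 0 = 0"
      by simp
  qed
  show ?thesis
    unfolding bdry_Delta_expand Delta_bdry_expand A_def [symmetric] B_def [symmetric]
      sum.distrib [symmetric] scaleR_right_distrib [symmetric]
    using cancel by (simp add: numeral_2_eq_2)
qed

theorem mainTheorem11:
  fixes brg :: "'g::real_vector \<Rightarrow> 'g \<Rightarrow> 'g" and brh :: "'h::real_vector \<Rightarrow> 'h \<Rightarrow> 'h"
    and \<mu> :: "'g \<Rightarrow> 'h" and L :: "'h \<Rightarrow> 'g \<Rightarrow> 'g"
    and \<phi> :: "'w::real_vector \<Rightarrow> 'v::real_vector"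
    and \<rho>01 :: "'h \<Rightarrow> 'w \<Rightarrow> 'w" and \<rho>00 :: "'h \<Rightarrow> 'v \<Rightarrow> 'v" and \<rho>1 :: "'g \<Rightarrow> 'v \<Rightarrow> 'w"
    and \<omega> :: "('g list \<times> 'h) list \<Rightarrow> 'g list \<Rightarrow> 'w"
    and p q r :: nat
  assumes "crossed_module brg brh \<mu> L"
    and "two_rep brg brh \<mu> L \<phi> \<rho>01 \<rho>00 \<rho>1"
    and "r \<ge> 1"
    and "cochain p q r \<omega>"
  shows "\<forall>\<Xi> Z. length \<Xi> = q + 1 \<and> set \<Xi> \<subseteq> gp (p + 2) \<and> length Z = r - 1 \<longrightarrow>
           (if r = 1 then
              bdry \<mu> (p + 1) (\<lambda>\<Xi>' Z'. \<phi> (Delta \<mu> \<omega> \<Xi>' Z')) \<Xi> Z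
                + \<phi> (Delta \<mu> (bdry \<mu> p \<omega>) \<Xi> Z) = 0
            else
              bdry \<mu> (p + 1) (Delta \<mu> \<omega>) \<Xi> Z + Delta \<mu> (bdry \<mu> p \<omega>) \<Xi> Z = 0)"
proof (intro allI impI)
  fix \<Xi> :: "('g list \<times> 'h) list" and Z :: "'g list"
  assume "length \<Xi> = q + 1 \<and> set \<Xi> \<subseteq> gp (p + 2) \<and> length Z = r - 1"
  then have anticommute: "bdry \<mu> (p + 1) (Delta \<mu> \<omega>) \<Xi> Z + Delta \<mu> (bdry \<mu> p \<omega>) \<Xi> Z = 0"
    using bdry_Delta_add_Delta_bdry[OF assms(4,3)] by blast
  have "linear \<phi>"
    using assms(2) unfolding two_rep_def by blast
  then show "if r = 1 then
              bdry \<mu> (p + 1) (\<lambda>\<Xi>' Z'. \<phi> (Delta \<mu> \<omega> \<Xi>' Z')) \<Xi> Z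
                + \<phi> (Delta \<mu> (bdry \<mu> p \<omega>) \<Xi> Z) = 0
            else
              bdry \<mu> (p + 1) (Delta \<mu> \<omega>) \<Xi> Z + Delta \<mu> (bdry \<mu> p \<omega>) \<Xi> Z = 0"
    using anticommute by (simp add: bdry_comp_linear linear_add [symmetric] linear_0)
qed

end
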